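(* Let $d\ge 1$ and let a signal $F\in\bar{\mathcal{P}}_d$ be given. Then for each integer $l$ with $1\le l\le d$ and each signal $\tilde F\in\mathcal{P}_{l-1}$, $$\|\bar m(F)-\bar m(\tilde F)\|\ \ge\ \min\left(1,\ \frac{\delta_l(F)}{\sqrt{2l-1}\;l^2\;l!\;(d+1)^{l-1}}\right).$$
   Context: For $n\ge 1$, $\mathcal{P}_n=\{(a,x)=(a_1,\ldots,a_n,x_1,\ldots,x_n)\in\mathbb{R}^{2n} : x_1<\cdots<x_n,\ a_i\neq 0,\ i=1,\ldots,n\}$; a tuple $(a,x)\in\mathcal{P}_n$ is identified with the signal $G(x)=\sum_{j=1}^n a_j\delta(x-x_j)$ with $n$ nodes. $\mathcal{P}_0$ is the singleton containing the zero signal. $\bar{\mathcal{P}}_d\subset\mathcal{P}_d$ is the set of signals for which $|x_j|\le 1$ and $|a_j|\le 1$ for all $j=1,\ldots,d$ (no such bounds are assumed for $\tilde F$). The moments of a signal $G=(a,x)\in\mathcal{P}_n$ are $m_k(G)=\sum_{j=1}^n a_jx_j^k$, $k\ge 0$ (with $x_j^0=1$); all moments of the zero signal are $0$. For any signal $G$, $\bar m(G)=(m_0(G),\ldots,m_{2d-2}(G))\in\mathbb{R}^{2d-1}$, and $\|\cdot\|$ is the Euclidean norm. $H_d(F)$ is the $d\times d$ Hankel matrix with entries $H_d(F)_{i,j}=m_{i+j}(F)$, $0\le i,j\le d-1$. For $l=1,\ldots,d$, $\delta_l(F)$ is the maximum of the absolute values of all $l$-minors of $H_d(F)$ (determinants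 of all $l\times l$ submatrices obtained by choosing any $l$ rows and any $l$ columns). *)

theory Defs
  imports
    Complex_Main
    "HOL-Analysis.L2_Norm"
    "Jordan_Normal_Form.Determinant"
    "Jordan_Normal_Form.DL_Submatrix"
begin

text \<open>
  A signal \<open>\<Sum>j. a\<^sub>j \<delta>(x - x\<^sub>j)\<close> is the pair \<open>(a, x)\<close> of its lists of amplitudes and nodes,
  indexed from 0. The signal without nodes, \<open>([], [])\<close>, is the zero signal.
\<close>
type_synonym signal = "real list \<times> real list"

definition signals :: "nat \<Rightarrow> signal set" where
  "signals n = {(a, x). length a = n \<and> length x = n \<and> sorted_wrt (<) x \<and> (\<forall>j<n. a ! j \<noteq> 0)}"

definition bounded_signals :: "nat \<Rightarrow> signal set" where
  "bounded_signals d = {(a, x) \<in> signals d. \<forall>j<d. \<bar>x ! j\<bar> \<le> 1 \<and> \<bar>a ! j\<bar> \<le> 1}"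

definition moment :: "nat \<Rightarrow> signal \<Rightarrow> real" where
  "moment k = (\<lambda>(a, x). \<Sum>j<length x. a ! j * (x ! j) ^ k)"

definition moment_vec :: "nat \<Rightarrow> signal \<Rightarrow> real vec" where
  "moment_vec d G = vec (2 * d - 1) (\<lambda>k. moment k G)"

definition euclidean_norm :: "real vec \<Rightarrow> real" where
  "euclidean_norm v = L2_set (\<lambda>i. v $ i) {..<dim_vec v}"

definition hankel :: "nat \<Rightarrow> signal \<Rightarrow> real mat" where
  "hankel d F = mat d d (\<lambda>(i, j). moment (i + j) F)"

definition minors :: "nat \<Rightarrow> real mat \<Rightarrow> real set" where
  "minors l A = {det (submatrix A I J) | I J.
     I \<subseteq> {..<dim_row A} \<and> J \<subseteq> {..<dim_col A} \<and> card I = l \<and> card J = l}"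

definition max_minor :: "nat \<Rightarrow> nat \<Rightarrow> signal \<Rightarrow> real" where
  "max_minor d l F = Max (abs ` minors l (hankel d F))"

end

theory Submission
  imports Defs
begin

text \<open>
  A signal with \<open>l - 1\<close> nodes has a Hankel matrix of rank at most \<open>l - 1\<close>, so its \<open>l\<close>-minors vanish,
  and every \<open>l\<close>-minor for \<open>F\<close> is a difference of two determinants whose entries differ by at most
  the distance \<open>\<epsilon>\<close> of the moment vectors. If \<open>\<epsilon> \<le> 1\<close>, all entries are bounded by \<open>d + 1\<close>, and
  expanding both determinants over permutations bounds their difference by \<open>l l! (d + 1)\<^sup>l\<^sup>-\<^sup>1 \<epsilon>\<close>.
  This is stronger than the claim by a factor \<open>l \<surd>(2l - 1)\<close>.
\<close>

text \<open>Divided by \<open>M\<close>, all factors lie in the unit ball, where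
  \<open>norm_prod_diff\<close> bounds the difference of the products by the sum of the differences
  of the factors. Scaling back multiplies by \<open>M ^ card I\<close>, and one factor
  \<open>M\<close> cancels against \<open>e / M\<close>.\<close>

lemma abs_prod_diff_le:
  fixes f g :: "'a \<Rightarrow> real" and M e :: real
  assumes "finite I" and "M > 0"
    and "\<And>i. i \<in> I \<Longrightarrow> \<bar>f i\<bar> \<le> M" and "\<And>i. i \<in> I \<Longrightarrow> \<bar>g i\<bar> \<le> M"
    and "\<And>i. i \<in> I \<Longrightarrow> \<bar>f i - g i\<bar> \<le> e"
  shows "\<bar>prod f I - prod g I\<bar> \<le> card I * M ^ (card I - 1) * e"
proof (cases "I = {}")
  case False
  then have card: "M ^ card I = M * M ^ (card I - 1)"
    using assms(1) by (metis card_gt_0_iff power_eq_if neq0_conv)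
  have "norm ((\<Prod>i\<in>I. f i / M) - (\<Prod>i\<in>I. g i / M)) \<le> (\<Sum>i\<in>I. norm (f i / M - g i / M))"
    using assms by (intro norm_prod_diff) auto
  also have "\<dots> \<le> (\<Sum>i\<in>I. e / M)"
    using assms by (intro sum_mono) (auto simp: diff_divide_distrib[symmetric] divide_right_mono)
  finally have "\<bar>prod f I - prod g I\<bar> / M ^ card I \<le> card I * (e / M)"
    using assms(2) by (simp add: prod_dividef diff_divide_distrib[symmetric])
  then show ?thesis
    using assms(2) by (simp add: card field_simps)
qed simp

lemma abs_det_diff_le:
  fixes A B :: "real mat" and M e :: real
  assumes A: "A \<in> carrier_mat n n" and B: "B \<in> carrier_mat n n" and "M > 0"
    and "\<And>i j. i < n \<Longrightarrow> j < n \<Longrightarrow> \<bar>A $$ (i, j)\<bar> \<le> M"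
    and "\<And>i j. i < n \<Longrightarrow> j < n \<Longrightarrow> \<bar>B $$ (i, j)\<bar> \<le> M"
    and "\<And>i j. i < n \<Longrightarrow> j < n \<Longrightarrow> \<bar>A $$ (i, j) - B $$ (i, j)\<bar> \<le> e"
  shows "\<bar>det A - det B\<bar> \<le> fact n * (n * M ^ (n - 1) * e)"
proof -
  let ?P = "{p. p permutes {0..<n}}"
  let ?prod = "\<lambda>C p. \<Prod>i = 0..<n. C $$ (i, p i)"
  have "\<bar>det A - det B\<bar> = \<bar>\<Sum>p\<in>?P. signof p * (?prod A p - ?prod B p)\<bar>"
    by (simp add: det_def'[OF A] det_def'[OF B] sum_subtractf algebra_simps)
  also have "\<dots> \<le> (\<Sum>p\<in>?P. \<bar>?prod A p - ?prod B p\<bar>)"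
    by (intro order_trans[OF sum_abs] sum_mono) (auto simp: abs_mult sign_def)
  also have "\<dots> \<le> (\<Sum>p\<in>?P. n * M ^ (n - 1) * e)"
  proof (intro sum_mono)
    fix p assume "p \<in> ?P"
    then have "p i < n" if "i < n" for i
      using that permutes_in_image[of p "{0..<n}" i] by auto
    then show "\<bar>?prod A p - ?prod B p\<bar> \<le> n * M ^ (n - 1) * e"
      using abs_prod_diff_le[where I = "{0..<n}" and M = M and e = e and
          f = "\<lambda>i. A $$ (i, p i)" and g = "\<lambda>i. B $$ (i, p i)"] assms
      by auto
  qed
  also have "\<dots> = fact n * (n * M ^ (n - 1) * e)"
    by (simp add: card_permutations[of _ n])
  finally show ?thesis .
qed

text \<open>The matrix factors through dimension \<open>m < n\<close>. Both factors are padded to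
  size \<open>n\<close>, so that \<open>det_mult\<close> applies and a zero row makes one
  determinant vanish.\<close>

lemma det_mat_sum_eq_0:
  fixes f g :: "nat \<Rightarrow> nat \<Rightarrow> 'a :: comm_ring_1"
  assumes "m < n"
  shows "det (mat n n (\<lambda>(i, j). \<Sum>s<m. f i s * g s j)) = 0"
proof -
  define P where "P = mat n n (\<lambda>(i, s). if s < m then f i s else 0)"
  \<comment> \<open>Row \<open>m\<close> is the zero row, in the form that \<open>det_row_0\<close>
    expects. Rows after it keep the values of \<open>g\<close>; they meet zero columns of
    \<open>P\<close>.\<close>
  define Q where "Q = mat\<^sub>r n n (\<lambda>s. if s = m then 0\<^sub>v n else vec n (g s))"
  have carrier: "P \<in> carrier_mat n n" "Q \<in> carrier_mat n n"
    by (auto simp: P_def Q_def)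
  have "mat n n (\<lambda>(i, j). \<Sum>s<m. f i s * g s j) = P * Q"
  proof (rule eq_matI)
    fix i j assume ij: "i < dim_row (P * Q)" "j < dim_col (P * Q)"
    then have "(P * Q) $$ (i, j) = (\<Sum>s = 0..<n. P $$ (i, s) * Q $$ (s, j))"
      using carrier by (simp add: scalar_prod_def)
    also have "\<dots> = (\<Sum>s<m. f i s * g s j)"
      using ij carrier assms
      by (intro sum.mono_neutral_cong_right) (auto simp: P_def Q_def)
    finally show "mat n n (\<lambda>(i, j). \<Sum>s<m. f i s * g s j) $$ (i, j) = (P * Q) $$ (i, j)"
      using ij carrier by simp
  qed (use carrier in auto)
  moreover have "det Q = 0"
    unfolding Q_def by (rule det_row_0[OF assms]) auto
  ultimately show ?thesis
    by (simp add: det_mult[OF carrier])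
qed

lemma submatrix_eq_mat:
  assumes "I \<subseteq> {..<dim_row A}" "J \<subseteq> {..<dim_col A}"
  shows "submatrix A I J = mat (card I) (card J) (\<lambda>(i, j). A $$ (pick I i, pick J j))"
proof -
  have "{i. i < dim_row A \<and> i \<in> I} = I" "{j. j < dim_col A \<and> j \<in> J} = J"
    using assms by auto
  then show ?thesis by (simp add: submatrix_def)
qed

lemma pick_less:
  assumes "I \<subseteq> {..<n}" "i < card I"
  shows "pick I i < n"
  using pick_in_set[of i I] assms by auto

lemma abs_moment_le:
  assumes "F \<in> bounded_signals d"
  shows "\<bar>moment k F\<bar> \<le> d"
proof -
  obtain a x where F: "F = (a, x)" "length x = d" "\<And>j. j < d \<Longrightarrow> \<bar>x ! j\<bar> \<le> 1 \<and> \<bar>a ! j\<bar> \<le> 1"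
    using assms by (auto simp: bounded_signals_def signals_def)
  have "\<bar>moment k F\<bar> \<le> (\<Sum>j<d. \<bar>a ! j * (x ! j) ^ k\<bar>)"
    by (simp add: F moment_def sum_abs)
  also have "\<dots> \<le> (\<Sum>j<d. 1)"
    using F(3) by (intro sum_mono) (simp add: abs_mult power_abs mult_le_one power_le_one)
  finally show ?thesis by simp
qed

lemma abs_moment_diff_le:
  assumes "k < 2 * d - 1"
  shows "\<bar>moment k F - moment k G\<bar> \<le> euclidean_norm (moment_vec d F - moment_vec d G)"
proof -
  \<comment> \<open>The absolute values turn \<open>member_le_L2_set\<close> into a two-sided bound;
    squaring removes them again.\<close>
  have "\<bar>moment k F - moment k G\<bar> \<le> L2_set (\<lambda>i. \<bar>moment i F - moment i G\<bar>) {..<2 * d - 1}"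
    using assms by (intro member_le_L2_set[of _ k "\<lambda>i. \<bar>moment i F - moment i G\<bar>"]) auto
  also have "\<dots> = euclidean_norm (moment_vec d F - moment_vec d G)"
    by (simp add: euclidean_norm_def moment_vec_def L2_set_def)
  finally show ?thesis .
qed

text \<open>Splitting the power of each node at \<open>i + j\<close> gives the Vandermonde
  factorization of the Hankel matrix. Its inner dimension is the number \<open>n\<close> of nodes,
  and submatrices inherit it.\<close>

lemma hankel_minor_eq_0:
  assumes "G \<in> signals n" "n < l" and IJ: "I \<subseteq> {..<d}" "J \<subseteq> {..<d}" "card I = l" "card J = l"
  shows "det (submatrix (hankel d G) I J) = 0"
proof -
  obtain a x where G: "G = (a, x)" "length x = n"
    using assms(1) by (auto simp: signals_def)
  have "submatrix (hankel d G) I J =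
      mat l l (\<lambda>(i, j). \<Sum>s<n. (a ! s * (x ! s) ^ pick I i) * (x ! s) ^ pick J j)"
    using IJ
    by (subst submatrix_eq_mat)
      (auto simp: hankel_def pick_less G moment_def power_add mult_ac intro!: eq_matI)
  then show ?thesis
    using det_mat_sum_eq_0[OF assms(2), of "\<lambda>i s. a ! s * (x ! s) ^ pick I i"] by simp
qed

lemma max_minor_attained:
  assumes "l \<le> d"
  obtains I J where "I \<subseteq> {..<d}" "J \<subseteq> {..<d}" "card I = l" "card J = l"
    "max_minor d l F = \<bar>det (submatrix (hankel d F) I J)\<bar>"
proof -
  let ?S = "{(I, J). I \<subseteq> {..<d} \<and> J \<subseteq> {..<d} \<and> card I = l \<and> card J = l}"
  have minors: "minors l (hankel d F) = (\<lambda>(I, J). det (submatrix (hankel d F) I J)) ` ?S"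
    by (auto simp: minors_def hankel_def)
  have "finite ?S"
    by (rule finite_subset[of _ "Pow {..<d} \<times> Pow {..<d}"]) auto
  moreover have "({..<l}, {..<l}) \<in> ?S"
    using assms by auto
  ultimately have "max_minor d l F \<in> abs ` minors l (hankel d F)"
    unfolding max_minor_def minors by (intro Max_in finite_imageI) blast+
  then show ?thesis
    using that unfolding minors by auto
qed

theorem theorem3p1:
  fixes d l :: nat and F F' :: signal
  assumes "d \<ge> 1"
    and "F \<in> bounded_signals d"
    and "1 \<le> l" and "l \<le> d"
    and "F' \<in> signals (l - 1)"
  shows "euclidean_norm (moment_vec d F - moment_vec d F') \<ge>
    min 1 (max_minor d l F /
      (sqrt (2 * real l - 1) * (real l)\<^sup>2 * fact l * (real d + 1) ^ (l - 1)))"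
proof -
  define e where "e = euclidean_norm (moment_vec d F - moment_vec d F')"
  \<comment> \<open>\<open>C\<close> is the constant that \<open>abs_det_diff_le\<close> yields for
    \<open>M = d + 1\<close>; the claimed constant \<open>D\<close> is
    \<open>sqrt (2 * l - 1) * l\<close> times \<open>C\<close>.\<close>
  define C where "C = fact l * (real l * (real d + 1) ^ (l - 1))"
  define D where "D = sqrt (2 * real l - 1) * (real l)\<^sup>2 * fact l * (real d + 1) ^ (l - 1)"
  have "0 < C"
    using assms(3) by (simp add: C_def)
  have "1 \<le> sqrt (2 * real l - 1) * real l"
    using assms(3) mult_mono[of 1 "sqrt (2 * real l - 1)" 1 "real l"] by simp
  then have "1 * C \<le> sqrt (2 * real l - 1) * real l * C"
    using \<open>0 < C\<close> by (intro mult_right_mono) auto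
  then have "C \<le> D"
    by (simp add: C_def D_def power2_eq_square mult_ac)
  obtain I J where IJ: "I \<subseteq> {..<d}" "J \<subseteq> {..<d}" "card I = l" "card J = l"
    and max_minor: "max_minor d l F = \<bar>det (submatrix (hankel d F) I J)\<bar>"
    using max_minor_attained[OF assms(4)] .
  have sub: "submatrix (hankel d G) I J = mat l l (\<lambda>(i, j). moment (pick I i + pick J j) G)" for G
    using IJ by (subst submatrix_eq_mat) (auto simp: hankel_def pick_less intro!: eq_matI)
  have "max_minor d l F \<le> C * e" if "e \<le> 1"
  proof -
    have diff: "\<bar>moment (pick I i + pick J j) F - moment (pick I i + pick J j) F'\<bar> \<le> e"
      if "i < l" "j < l" for i j
    proof -
      \<comment> \<open>Both indices are at most \<open>d - 1\<close>, so their sum is at most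
        \<open>2 * d - 2\<close>, the last index of the moment vector.\<close>
      have "pick I i < d" "pick J j < d"
        using IJ that by (auto intro!: pick_less)
      then show ?thesis
        unfolding e_def by (intro abs_moment_diff_le) auto
    qed
    have bound: "\<bar>moment k F\<bar> \<le> d" for k
      using abs_moment_le[OF assms(2)] .
    \<comment> \<open>No bound on \<open>F'\<close> is given: its moments are controlled only
      through those of \<open>F\<close>, and \<open>e \<le> 1\<close> accounts for the summand
      1.\<close>
    have "\<bar>moment (pick I i + pick J j) F'\<bar> \<le> real d + 1" if "i < l" "j < l" for i j
      using diff[OF that] bound[of "pick I i + pick J j"] \<open>e \<le> 1\<close> by linarith
    moreover have "\<bar>moment k F\<bar> \<le> real d + 1" for k
      using bound[of k] by simp
    ultimately have "\<bar>det (submatrix (hankel d F) I J) - det (submatrix (hankel d F') I J)\<bar>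
        \<le> fact l * (real l * (real d + 1) ^ (l - 1) * e)"
      using diff by (intro abs_det_diff_le) (auto simp: sub)
    moreover have "det (submatrix (hankel d F') I J) = 0"
      using assms(3,5) IJ by (intro hankel_minor_eq_0) auto
    ultimately show ?thesis
      by (simp add: max_minor C_def mult_ac)
  qed
  \<comment> \<open>Enlarging the denominator is allowed because \<open>max_minor\<close>, being an
    absolute value, is nonnegative.\<close>
  moreover have "max_minor d l F / D \<le> max_minor d l F / C"
    using \<open>C \<le> D\<close> \<open>0 < C\<close> by (intro divide_left_mono) (auto simp: max_minor)
  ultimately have "e \<le> 1 \<Longrightarrow> max_minor d l F / D \<le> e"
    using \<open>0 < C\<close> by (smt (verit) pos_divide_le_eq mult.commute)
  \<comment> \<open>If \<open>e > 1\<close>, the minimum is at most 1 and the claim is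
    immediate.\<close>
  then show ?thesis
    unfolding e_def[symmetric] D_def[symmetric] by linarith
qed

end
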